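(* Let $\mathbb{T}=(T,m,e)$ be a monad on $\mathbf{Set}$ with $T\colon\mathbf{Set}\to\mathbf{Set}$ satisfying the Beck–Chevalley condition, let $\mathsf{V}$ be a commutative quantale and let the map $\xi\colon T\mathsf{V}\to\mathsf{V}$ be monotone. Then $T_{\xi}$ is the least of all admissible, left-op-whiskering and monotone extension families $\hat{T}$ with $\Xi(\hat{T})=\xi$ (with respect to the order $\hat{T}\le\hat{T}'$ iff $\hat{T}\varphi\le\hat{T}'\varphi$ for all $\varphi$).
   Context: A (unital) quantale $\mathsf{V}$ is a complete lattice with a monoid structure $(\otimes,\mathsf{k})$ such that $\otimes$ preserves suprema in each variable. $T$ satisfies the Beck–Chevalley condition (BC) if $T$ transforms (weak) pullback diagrams in $\mathbf{Set}$ into weak pullback diagrams. A map $\xi\colon T\mathsf{V}\to\mathsf{V}$ is called monotone if for all sets $Y$ and maps $f,g\colon Y\to\mathsf{V}$, $f\le g$ (pointwise) implies $\xi\cdot Tf\le\xi\cdot Tg$. A $\mathsf{V}$-relation $\varphi\colon X\nrightarrow Y$ is a map assigning $\varphi(x,y)\in\mathsf{V}$ to $x\in X$, $y\in Y$; composition is $(\psi\circ\varphi)(x,z)=\bigvee_y\psi(y,z)\otimes\varphi(x,y)$, and the order is pointwise. For a map $h\colon Z\to Y$, $h^\circ\colon Y\nrightarrow Z$ is $h^\circ(y,z)=\mathsf{k}$ if $h(z)=y$ and $\bot$ otherwise. For $\varphi\colon X\nrightarrow Y$ write $|\varphi|\colon X\times Y\to\mathsf{V}$ for the map of values of $\varphi$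 and $\varphi^1\colon1\nrightarrow X\times Y$ for the $\mathsf{V}$-relation with the same values, $1$ a singleton set. $\varepsilon_1\colon1\nrightarrow\mathsf{V}$ is the $\mathsf{V}$-relation $\varepsilon_1( *,v)=v$. An extension family is a family of $\mathsf{V}$-relations $\hat{T}\varphi\colon TX\nrightarrow TY$, one for each $\mathsf{V}$-relation $\varphi\colon X\nrightarrow Y$. It is monotone if $\varphi\le\varphi'\Rightarrow\hat{T}\varphi\le\hat{T}\varphi'$; left-op-whiskering if $\hat{T}(h^\circ\circ\varphi)=(Th)^\circ\circ\hat{T}\varphi$ for all $\varphi\colon X\nrightarrow Y$ and maps $h\colon Z\to Y$; and admissible if for all $\varphi\colon X\nrightarrow Y$, $\mathfrak{x}\in TX$, $\mathfrak{y}\in TY$, $$\hat{T}\varphi(\mathfrak{x},\mathfrak{y})\ge\bigvee\{\hat{T}(\varphi^1)(\mathfrak{b},\mathfrak{w})\mid\mathfrak{b}\in T1,\ \mathfrak{w}\in T(X\times Y),\ T\pi_1(\mathfrak{w})=\mathfrak{x},\ T\pi_2(\mathfrak{w})=\mathfrak{y}\}.$$ For an extension family $\hat{T}$, the map $\Xi(\hat{T})\colon T\mathsf{V}\to\mathsf{V}$ is $\Xi(\hat{T})(\mathfrak{a})=\bigvee_{\mathfrak{b}\in T1}(\hat{T}\varepsilon_1)(\mathfrak{b},\mathfrak{a})$. For a map $\xi\colon T\mathsf{V}\to\mathsf{V}$, the extension family $T_\xi$ is defined by $$(T_\xi\varphi)(\mathfrak{x},\mathfrak{y})=\bigvee\{\xi(T|\varphi|(\mathfrak{w}))\mid\mathfrak{w}\in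 T(X\times Y),\ T\pi_1(\mathfrak{w})=\mathfrak{x},\ T\pi_2(\mathfrak{w})=\mathfrak{y}\}$$ for all $\varphi\colon X\nrightarrow Y$, $\mathfrak{x}\in TX$, $\mathfrak{y}\in TY$. *)

theory Defs
  imports "HOL-Library.FuncSet"
begin

class quantale = complete_lattice + monoid_mult +
  assumes mult_Sup: "a * Sup B = Sup ((\<lambda>b. a * b) ` B)"
    and Sup_mult: "Sup B * a = Sup ((\<lambda>b. b * a) ` B)"

class comm_quantale = quantale + comm_monoid_mult

text \<open>
  HOL has no type of all sets over which a functor could act, so the category of sets is given by
  a universe: a collection of subsets of a type \<open>'u\<close>, the \<^emph>\<open>small\<close> sets, closed under the set
  formation that is used below. If the elements of \<open>'u\<close> are the members of a Grothendieck universe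
  (or of a model of ZFC) and the small sets are those that are coded by a member, this is the
  category of sets in the usual sense. Further closure properties, such as power sets, are not
  demanded, so the small sets may also be the finite or the countable subsets of \<open>nat\<close>, for
  instance. Ordered pairs of elements are coded in \<open>'u\<close> by an injection.
\<close>

record 'u universe =
  Sets :: "'u set set"
  pair :: "'u \<times> 'u \<Rightarrow> 'u"
  pt :: 'u

definition One :: "'u universe \<Rightarrow> 'u set" where
  "One U = {pt U}"

definition Prod :: "'u universe \<Rightarrow> 'u set \<Rightarrow> 'u set \<Rightarrow> 'u set" where
  "Prod U X Y = pair U ` (X \<times> Y)"

definition pr1 :: "'u universe \<Rightarrow> 'u \<Rightarrow> 'u" where
  "pr1 U w = fst (inv (pair U) w)"

definition pr2 :: "'u universe \<Rightarrow> 'u \<Rightarrow> 'u" where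
  "pr2 U w = snd (inv (pair U) w)"

locale set_universe =
  fixes U :: "'u universe"
  assumes inj_pair: "inj (pair U)"
    and finite_small: "finite X \<Longrightarrow> X \<in> Sets U"
    and subset_small: "X \<in> Sets U \<Longrightarrow> Y \<subseteq> X \<Longrightarrow> Y \<in> Sets U"
    and image_small: "X \<in> Sets U \<Longrightarrow> f ` X \<in> Sets U"
    and Prod_small: "X \<in> Sets U \<Longrightarrow> Y \<in> Sets U \<Longrightarrow> Prod U X Y \<in> Sets U"

text \<open>
  A map \<open>X \<rightarrow> Y\<close> of small sets is represented by any function whose restriction to \<open>X\<close> it is.
  Hence equality of maps is equality on \<open>X\<close>, and operations on maps have to respect it
  (\<open>Mor_cong\<close>). \<open>Mor T X Y f\<close> is \<open>Tf: TX \<rightarrow> TY\<close>; it also depends on the domain and codomain of \<open>f\<close>.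
\<close>

record 'u setfunctor =
  Ob :: "'u set \<Rightarrow> 'u set"
  Mor :: "'u set \<Rightarrow> 'u set \<Rightarrow> ('u \<Rightarrow> 'u) \<Rightarrow> 'u \<Rightarrow> 'u"

locale set_functor = set_universe U for U :: "'u universe" +
  fixes T :: "'u setfunctor"
  assumes Ob_small: "X \<in> Sets U \<Longrightarrow> Ob T X \<in> Sets U"
    and Mor_maps: "X \<in> Sets U \<Longrightarrow> Y \<in> Sets U \<Longrightarrow> f \<in> X \<rightarrow> Y \<Longrightarrow> Mor T X Y f \<in> Ob T X \<rightarrow> Ob T Y"
    and Mor_cong: "X \<in> Sets U \<Longrightarrow> Y \<in> Sets U \<Longrightarrow> f \<in> X \<rightarrow> Y \<Longrightarrow> g \<in> X \<rightarrow> Y \<Longrightarrow>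
        (\<And>x. x \<in> X \<Longrightarrow> f x = g x) \<Longrightarrow> t \<in> Ob T X \<Longrightarrow> Mor T X Y f t = Mor T X Y g t"
    and Mor_id: "X \<in> Sets U \<Longrightarrow> t \<in> Ob T X \<Longrightarrow> Mor T X X (\<lambda>x. x) t = t"
    and Mor_comp: "X \<in> Sets U \<Longrightarrow> Y \<in> Sets U \<Longrightarrow> Z \<in> Sets U \<Longrightarrow> f \<in> X \<rightarrow> Y \<Longrightarrow> g \<in> Y \<rightarrow> Z \<Longrightarrow>
        t \<in> Ob T X \<Longrightarrow> Mor T X Z (\<lambda>x. g (f x)) t = Mor T Y Z g (Mor T X Y f t)"

locale set_monad = set_functor U T for U :: "'u universe" and T :: "'u setfunctor" +
  fixes m :: "'u set \<Rightarrow> 'u \<Rightarrow> 'u" and e :: "'u set \<Rightarrow> 'u \<Rightarrow> 'u"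
  assumes unit_maps: "X \<in> Sets U \<Longrightarrow> e X \<in> X \<rightarrow> Ob T X"
    and mult_maps: "X \<in> Sets U \<Longrightarrow> m X \<in> Ob T (Ob T X) \<rightarrow> Ob T X"
    and unit_natural: "X \<in> Sets U \<Longrightarrow> Y \<in> Sets U \<Longrightarrow> f \<in> X \<rightarrow> Y \<Longrightarrow> x \<in> X \<Longrightarrow>
        Mor T X Y f (e X x) = e Y (f x)"
    and mult_natural: "X \<in> Sets U \<Longrightarrow> Y \<in> Sets U \<Longrightarrow> f \<in> X \<rightarrow> Y \<Longrightarrow> t \<in> Ob T (Ob T X) \<Longrightarrow>
        Mor T X Y f (m X t) = m Y (Mor T (Ob T X) (Ob T Y) (Mor T X Y f) t)"
    and left_unit: "X \<in> Sets U \<Longrightarrow> t \<in> Ob T X \<Longrightarrow> m X (e (Ob T X) t) = t"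
    and right_unit: "X \<in> Sets U \<Longrightarrow> t \<in> Ob T X \<Longrightarrow> m X (Mor T X (Ob T X) (e X) t) = t"
    and assoc: "X \<in> Sets U \<Longrightarrow> t \<in> Ob T (Ob T (Ob T X)) \<Longrightarrow>
        m X (m (Ob T X) t) = m X (Mor T (Ob T (Ob T X)) (Ob T X) (m X) t)"

text \<open>The square \<open>f \<cdot> p = g \<cdot> q\<close> with \<open>p: P \<rightarrow> X\<close>, \<open>q: P \<rightarrow> Y\<close>, \<open>f: X \<rightarrow> Z\<close>, \<open>g: Y \<rightarrow> Z\<close>.\<close>

definition weak_pullback ::
  "'u universe \<Rightarrow> 'u set \<Rightarrow> 'u set \<Rightarrow> 'u set \<Rightarrow> 'u set \<Rightarrow>
   ('u \<Rightarrow> 'u) \<Rightarrow> ('u \<Rightarrow> 'u) \<Rightarrow> ('u \<Rightarrow> 'u) \<Rightarrow> ('u \<Rightarrow> 'u) \<Rightarrow> bool" where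
  "weak_pullback U P X Y Z p q f g \<longleftrightarrow>
    P \<in> Sets U \<and> X \<in> Sets U \<and> Y \<in> Sets U \<and> Z \<in> Sets U \<and>
    p \<in> P \<rightarrow> X \<and> q \<in> P \<rightarrow> Y \<and> f \<in> X \<rightarrow> Z \<and> g \<in> Y \<rightarrow> Z \<and>
    (\<forall>w\<in>P. f (p w) = g (q w)) \<and>
    (\<forall>W\<in>Sets U. \<forall>a\<in>W \<rightarrow> X. \<forall>b\<in>W \<rightarrow> Y. (\<forall>w\<in>W. f (a w) = g (b w)) \<longrightarrow>
      (\<exists>h\<in>W \<rightarrow> P. \<forall>w\<in>W. p (h w) = a w \<and> q (h w) = b w))"

text \<open>
  By the axiom of choice, sending pullbacks to weak pullbacks and sending weak pullbacks to weak
  pullbacks are the same condition on a functor on sets.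
\<close>

definition beck_chevalley :: "'u universe \<Rightarrow> 'u setfunctor \<Rightarrow> bool" where
  "beck_chevalley U T \<longleftrightarrow>
    (\<forall>P X Y Z p q f g. weak_pullback U P X Y Z p q f g \<longrightarrow>
      weak_pullback U (Ob T P) (Ob T X) (Ob T Y) (Ob T Z)
        (Mor T P X p) (Mor T P Y q) (Mor T X Z f) (Mor T Y Z g))"

text \<open>
  A quantale is a type \<open>'v\<close>; its underlying set becomes an object of the universe by an
  injection \<open>c :: 'v \<Rightarrow> 'u\<close> with small range, so that \<open>TV\<close> is \<open>Ob T (range c)\<close>, and a map
  \<open>f: Y \<rightarrow> V\<close> is the map \<open>\<lambda>y. c (f y)\<close> into \<open>range c\<close>.
\<close>

definition monotone_map ::
  "'u universe \<Rightarrow> 'u setfunctor \<Rightarrow> ('v::comm_quantale \<Rightarrow> 'u) \<Rightarrow> ('u \<Rightarrow> 'v) \<Rightarrow> bool" where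
  "monotone_map U T c \<xi> \<longleftrightarrow>
    (\<forall>Y\<in>Sets U. \<forall>f g. (\<forall>y\<in>Y. f y \<le> g y) \<longrightarrow>
      (\<forall>t\<in>Ob T Y. \<xi> (Mor T Y (range c) (\<lambda>y. c (f y)) t) \<le> \<xi> (Mor T Y (range c) (\<lambda>y. c (g y)) t)))"

text \<open>
  A relation from \<open>X\<close> to \<open>Y\<close> with values in \<open>'v\<close> is likewise represented by any function with the
  right values on \<open>X \<times> Y\<close>; values elsewhere are irrelevant.
\<close>

type_synonym ('u, 'v) vrel = "'u \<Rightarrow> 'u \<Rightarrow> 'v"

definition vrel_le :: "'u set \<Rightarrow> 'u set \<Rightarrow> ('u, 'v::comm_quantale) vrel \<Rightarrow> ('u, 'v) vrel \<Rightarrow> bool" where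
  "vrel_le X Y \<phi> \<psi> \<longleftrightarrow> (\<forall>x\<in>X. \<forall>y\<in>Y. \<phi> x y \<le> \<psi> x y)"

definition vrel_eq :: "'u set \<Rightarrow> 'u set \<Rightarrow> ('u, 'v::comm_quantale) vrel \<Rightarrow> ('u, 'v) vrel \<Rightarrow> bool" where
  "vrel_eq X Y \<phi> \<psi> \<longleftrightarrow> (\<forall>x\<in>X. \<forall>y\<in>Y. \<phi> x y = \<psi> x y)"

text \<open>\<open>vcomp Y \<psi> \<phi>\<close> is \<open>\<psi> \<circ> \<phi>\<close>, where \<open>Y\<close> is the codomain of \<open>\<phi>\<close> and the domain of \<open>\<psi>\<close>.\<close>

definition vcomp :: "'u set \<Rightarrow> ('u, 'v::comm_quantale) vrel \<Rightarrow> ('u, 'v) vrel \<Rightarrow> ('u, 'v) vrel" where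
  "vcomp Y \<psi> \<phi> x z = (SUP y\<in>Y. \<psi> y z * \<phi> x y)"

text \<open>\<open>op_rel h\<close> is \<open>h\<^sup>\<circ>\<close>.\<close>

definition op_rel :: "('u \<Rightarrow> 'u) \<Rightarrow> ('u, 'v::comm_quantale) vrel" where
  "op_rel h y z = (if h z = y then 1 else bot)"

text \<open>\<open>vmap U \<phi>\<close> is the map \<open>|\<phi>|\<close> on \<open>X \<times> Y\<close>, and \<open>from_one U \<phi>\<close> is \<open>\<phi>\<^sup>1\<close>.\<close>

definition vmap :: "'u universe \<Rightarrow> ('u, 'v::comm_quantale) vrel \<Rightarrow> 'u \<Rightarrow> 'v" where
  "vmap U \<phi> w = \<phi> (pr1 U w) (pr2 U w)"

definition from_one :: "'u universe \<Rightarrow> ('u, 'v::comm_quantale) vrel \<Rightarrow> ('u, 'v) vrel" where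
  "from_one U \<phi> z w = vmap U \<phi> w"

definition eps_one :: "('v::comm_quantale \<Rightarrow> 'u) \<Rightarrow> ('u, 'v) vrel" where
  "eps_one c z a = inv c a"

text \<open>A family assigns to \<open>X\<close>, \<open>Y\<close> and a relation from \<open>X\<close> to \<open>Y\<close> a relation from \<open>TX\<close> to \<open>TY\<close>.\<close>

type_synonym ('u, 'v) vfamily = "'u set \<Rightarrow> 'u set \<Rightarrow> ('u, 'v) vrel \<Rightarrow> ('u, 'v) vrel"

text \<open>Being an extension family only means not to depend on the irrelevant values.\<close>

definition extension_family ::
  "'u universe \<Rightarrow> 'u setfunctor \<Rightarrow> ('u, 'v::comm_quantale) vfamily \<Rightarrow> bool" where
  "extension_family U T E \<longleftrightarrow>
    (\<forall>X\<in>Sets U. \<forall>Y\<in>Sets U. \<forall>\<phi> \<phi>'. vrel_eq X Y \<phi> \<phi>' \<longrightarrow>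
      vrel_eq (Ob T X) (Ob T Y) (E X Y \<phi>) (E X Y \<phi>'))"

definition family_le ::
  "'u universe \<Rightarrow> 'u setfunctor \<Rightarrow> ('u, 'v::comm_quantale) vfamily \<Rightarrow> ('u, 'v) vfamily \<Rightarrow> bool" where
  "family_le U T E E' \<longleftrightarrow>
    (\<forall>X\<in>Sets U. \<forall>Y\<in>Sets U. \<forall>\<phi>. vrel_le (Ob T X) (Ob T Y) (E X Y \<phi>) (E' X Y \<phi>))"

definition monotone_family ::
  "'u universe \<Rightarrow> 'u setfunctor \<Rightarrow> ('u, 'v::comm_quantale) vfamily \<Rightarrow> bool" where
  "monotone_family U T E \<longleftrightarrow>
    (\<forall>X\<in>Sets U. \<forall>Y\<in>Sets U. \<forall>\<phi> \<phi>'. vrel_le X Y \<phi> \<phi>' \<longrightarrow>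
      vrel_le (Ob T X) (Ob T Y) (E X Y \<phi>) (E X Y \<phi>'))"

definition left_op_whiskering ::
  "'u universe \<Rightarrow> 'u setfunctor \<Rightarrow> ('u, 'v::comm_quantale) vfamily \<Rightarrow> bool" where
  "left_op_whiskering U T E \<longleftrightarrow>
    (\<forall>X\<in>Sets U. \<forall>Y\<in>Sets U. \<forall>Z\<in>Sets U. \<forall>\<phi>. \<forall>h\<in>Z \<rightarrow> Y.
      vrel_eq (Ob T X) (Ob T Z) (E X Z (vcomp Y (op_rel h) \<phi>))
        (vcomp (Ob T Y) (op_rel (Mor T Z Y h)) (E X Y \<phi>)))"

definition admissible ::
  "'u universe \<Rightarrow> 'u setfunctor \<Rightarrow> ('u, 'v::comm_quantale) vfamily \<Rightarrow> bool" where
  "admissible U T E \<longleftrightarrow>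
    (\<forall>X\<in>Sets U. \<forall>Y\<in>Sets U. \<forall>\<phi>. \<forall>x\<in>Ob T X. \<forall>y\<in>Ob T Y.
      Sup {E (One U) (Prod U X Y) (from_one U \<phi>) b w | b w.
        b \<in> Ob T (One U) \<and> w \<in> Ob T (Prod U X Y) \<and>
        Mor T (Prod U X Y) X (pr1 U) w = x \<and> Mor T (Prod U X Y) Y (pr2 U) w = y}
      \<le> E X Y \<phi> x y)"

definition Xi ::
  "'u universe \<Rightarrow> 'u setfunctor \<Rightarrow> ('v::comm_quantale \<Rightarrow> 'u) \<Rightarrow> ('u, 'v) vfamily \<Rightarrow> 'u \<Rightarrow> 'v" where
  "Xi U T c E a = (SUP b\<in>Ob T (One U). E (One U) (range c) (eps_one c) b a)"

definition T_ext ::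
  "'u universe \<Rightarrow> 'u setfunctor \<Rightarrow> ('v::comm_quantale \<Rightarrow> 'u) \<Rightarrow> ('u \<Rightarrow> 'v) \<Rightarrow> ('u, 'v) vfamily" where
  "T_ext U T c \<xi> X Y \<phi> x y =
    Sup {\<xi> (Mor T (Prod U X Y) (range c) (\<lambda>w. c (vmap U \<phi> w)) w) | w.
      w \<in> Ob T (Prod U X Y) \<and>
      Mor T (Prod U X Y) X (pr1 U) w = x \<and> Mor T (Prod U X Y) Y (pr2 U) w = y}"

end

theory Submission
  imports Defs
begin

text \<open>
  Every relation \<open>\<phi>: X \<nrightarrow> Y\<close> is encoded by its map of values \<open>|\<phi>|: X \<times> Y \<rightarrow> V\<close>, and
  \<open>\<phi>\<^sup>1 = |\<phi>|\<^sup>\<circ> \<circ> \<epsilon>\<^sub>1\<close> recovers these values from the single relation \<open>\<epsilon>\<^sub>1\<close>. A left-op-whiskering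
  family \<open>E\<close> is therefore determined on the relations \<open>\<phi>\<^sup>1\<close> by its value at \<open>\<epsilon>\<^sub>1\<close>. Joining over
  \<open>T1\<close>, the condition \<open>\<Xi>(E) = \<xi>\<close> says that \<open>\<Squnion>\<^sub>b E(\<phi>\<^sup>1)(b, w) = \<xi>(T|\<phi>|(w))\<close>; admissibility
  compares the left side with \<open>E\<phi>\<close> at the two projections of \<open>w\<close>, and the join of the right
  sides over all \<open>w\<close> with given projections is \<open>T\<^sub>\<xi>\<phi>\<close>. This is the minimality
  (\<open>T_ext_least\<close>).

  It remains that \<open>T\<^sub>\<xi>\<close> is itself such a family. Monotonicity is that of \<open>\<xi>\<close>. Admissibility
  holds because \<open>|\<phi>\<^sup>1|\<close> is \<open>|\<phi>|\<close> after the projection \<open>1 \<times> (X \<times> Y) \<rightarrow> X \<times> Y\<close>, and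
  \<open>\<Xi>(T\<^sub>\<xi>) = \<xi>\<close> because the projection \<open>1 \<times> V \<rightarrow> V\<close> is invertible. The whiskering law is where
  the Beck-Chevalley condition enters: \<open>h\<^sup>\<circ> \<circ> \<phi>\<close> has the values \<open>|\<phi>| \<cdot> (id \<times> h)\<close>, and an element
  of \<open>T(X \<times> Y)\<close> lying over \<open>Th(z)\<close> has to be lifted along \<open>T(id \<times> h)\<close> to one lying over \<open>z\<close>
  (\<open>lift_along_product\<close>).
\<close>

section \<open>Relations with values in a quantale\<close>

lemma quantale_bot_mult [simp]: "(bot::'v::quantale) * a = bot"
  using Sup_mult[of "{}" a] by simp

lemma vcomp_op_rel:
  fixes \<phi> :: "('u, 'v::comm_quantale) vrel"
  assumes "h z \<in> Y"
  shows "vcomp Y (op_rel h) \<phi> x z = \<phi> x (h z)"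
  unfolding vcomp_def
proof (rule antisym)
  show "(SUP y\<in>Y. op_rel h y z * \<phi> x y) \<le> \<phi> x (h z)"
    by (rule SUP_least) (auto simp: op_rel_def)
  show "\<phi> x (h z) \<le> (SUP y\<in>Y. op_rel h y z * \<phi> x y)"
    by (rule SUP_upper2[OF assms]) (simp add: op_rel_def)
qed

lemma extension_family_if_monotone:
  fixes E :: "('a, 'b::comm_quantale) vfamily"
  assumes "monotone_family U T E"
  shows "extension_family U T E"
proof -
  have "vrel_eq A B \<phi> \<psi> \<longleftrightarrow> vrel_le A B \<phi> \<psi> \<and> vrel_le A B \<psi> \<phi>"
    for A B and \<phi> \<psi> :: "('a, 'b) vrel"
    by (auto simp: vrel_eq_def vrel_le_def intro: antisym)
  then show ?thesis
    using assms unfolding monotone_family_def extension_family_def by simp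
qed

section \<open>Products of small sets\<close>

context set_universe
begin

lemma pr1_pair [simp]: "pr1 U (pair U (x, y)) = x"
  and pr2_pair [simp]: "pr2 U (pair U (x, y)) = y"
  using inj_pair by (simp_all add: pr1_def pr2_def)

lemma ProdE:
  assumes "w \<in> Prod U X Y"
  obtains x y where "w = pair U (x, y)" "x \<in> X" "y \<in> Y"
  using assms by (auto simp: Prod_def)

lemma pair_in_Prod: "x \<in> X \<Longrightarrow> y \<in> Y \<Longrightarrow> pair U (x, y) \<in> Prod U X Y"
  by (simp add: Prod_def)

lemma pr1_maps: "pr1 U \<in> Prod U X Y \<rightarrow> X"
  and pr2_maps: "pr2 U \<in> Prod U X Y \<rightarrow> Y"
  by (auto elim!: ProdE)

lemma One_small: "One U \<in> Sets U"
  by (simp add: One_def finite_small)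

definition id_times :: "('u \<Rightarrow> 'u) \<Rightarrow> 'u \<Rightarrow> 'u" where
  "id_times h w = pair U (pr1 U w, h (pr2 U w))"

lemma pr1_id_times [simp]: "pr1 U (id_times h w) = pr1 U w"
  and pr2_id_times [simp]: "pr2 U (id_times h w) = h (pr2 U w)"
  by (simp_all add: id_times_def)

lemma id_times_maps: "h \<in> Z \<rightarrow> Y \<Longrightarrow> id_times h \<in> Prod U X Z \<rightarrow> Prod U X Y"
  by (auto simp: id_times_def Prod_def)

text \<open>
  A cone over this square is a map into \<open>X \<times> Z\<close>: its second leg is the component in \<open>Z\<close>, and the
  component in \<open>X\<close> is that of its first leg, whose component in \<open>Y\<close> is forced by commutativity.
\<close>

lemma weak_pullback_id_times:
  assumes "X \<in> Sets U" "Y \<in> Sets U" "Z \<in> Sets U" "h \<in> Z \<rightarrow> Y"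
  shows "weak_pullback U (Prod U X Z) (Prod U X Y) Z Y (id_times h) (pr2 U) (pr2 U) h"
  unfolding weak_pullback_def
proof (intro conjI ballI impI)
  fix W a b
  assume a: "a \<in> W \<rightarrow> Prod U X Y" and b: "b \<in> W \<rightarrow> Z" and ab: "\<forall>w\<in>W. pr2 U (a w) = h (b w)"
  let ?k = "\<lambda>w. pair U (pr1 U (a w), b w)"
  have "?k \<in> W \<rightarrow> Prod U X Z"
    using a b pr1_maps by (blast intro: pair_in_Prod)
  moreover have "id_times h (?k w) = a w \<and> pr2 U (?k w) = b w" if "w \<in> W" for w
  proof -
    obtain x y where "a w = pair U (x, y)"
      using a \<open>w \<in> W\<close> by (blast elim: ProdE)
    then show ?thesis
      using ab \<open>w \<in> W\<close> by (auto simp: id_times_def)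
  qed
  ultimately show "\<exists>k\<in>W \<rightarrow> Prod U X Z. \<forall>w\<in>W. id_times h (k w) = a w \<and> pr2 U (k w) = b w"
    by (intro bexI[of _ ?k]) auto
qed (use assms in \<open>auto intro: Prod_small simp: id_times_maps pr2_maps\<close>)

text \<open>A pair of elements with equal images is a cone with vertex \<open>1\<close>.\<close>

lemma weak_pullback_element:
  assumes "weak_pullback U P X Y Z p q f g" "x \<in> X" "y \<in> Y" "f x = g y"
  obtains w where "w \<in> P" "p w = x" "q w = y"
proof -
  have "\<exists>k\<in>One U \<rightarrow> P. \<forall>w\<in>One U. p (k w) = x \<and> q (k w) = y"
    using assms One_small unfolding weak_pullback_def by (metis Pi_I)
  then show thesis
    using that by (auto simp: One_def)
qed

end

section \<open>Functors with the Beck-Chevalley condition\<close>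

context set_functor
begin

lemma Mor_in: "X \<in> Sets U \<Longrightarrow> Y \<in> Sets U \<Longrightarrow> f \<in> X \<rightarrow> Y \<Longrightarrow> t \<in> Ob T X \<Longrightarrow> Mor T X Y f t \<in> Ob T Y"
  using Mor_maps by blast

lemma Mor_factor:
  assumes "X \<in> Sets U" "Y \<in> Sets U" "Z \<in> Sets U" "f \<in> X \<rightarrow> Y" "g \<in> Y \<rightarrow> Z"
    and "\<And>x. x \<in> X \<Longrightarrow> k x = g (f x)" and "t \<in> Ob T X"
  shows "Mor T X Z k t = Mor T Y Z g (Mor T X Y f t)"
proof -
  have "Mor T X Z k t = Mor T X Z (\<lambda>x. g (f x)) t"
    using assms by (intro Mor_cong) auto
  then show ?thesis
    using assms Mor_comp by simp
qed

lemma lift_along_product: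
  assumes "beck_chevalley U T" and small: "X \<in> Sets U" "Y \<in> Sets U" "Z \<in> Sets U" and "h \<in> Z \<rightarrow> Y"
    and "v \<in> Ob T (Prod U X Y)" "z \<in> Ob T Z" "Mor T (Prod U X Y) Y (pr2 U) v = Mor T Z Y h z"
  obtains w where "w \<in> Ob T (Prod U X Z)" "Mor T (Prod U X Z) (Prod U X Y) (id_times h) w = v"
    "Mor T (Prod U X Z) Z (pr2 U) w = z"
proof -
  have "weak_pullback U (Ob T (Prod U X Z)) (Ob T (Prod U X Y)) (Ob T Z) (Ob T Y)
      (Mor T (Prod U X Z) (Prod U X Y) (id_times h)) (Mor T (Prod U X Z) Z (pr2 U))
      (Mor T (Prod U X Y) Y (pr2 U)) (Mor T Z Y h)"
    using assms(1) weak_pullback_id_times[OF small \<open>h \<in> Z \<rightarrow> Y\<close>]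
    unfolding beck_chevalley_def by blast
  from weak_pullback_element[OF this, OF assms(6-8)] show thesis
    using that by blast
qed

section \<open>The extension induced by a map on the quantale\<close>

lemma T_ext_leI:
  fixes c :: "'v::comm_quantale \<Rightarrow> 'u"
  assumes "\<And>w. w \<in> Ob T (Prod U X Y) \<Longrightarrow> Mor T (Prod U X Y) X (pr1 U) w = x \<Longrightarrow>
      Mor T (Prod U X Y) Y (pr2 U) w = y \<Longrightarrow>
      \<xi> (Mor T (Prod U X Y) (range c) (\<lambda>w. c (vmap U \<phi> w)) w) \<le> v"
  shows "T_ext U T c \<xi> X Y \<phi> x y \<le> v"
  unfolding T_ext_def using assms by (auto intro!: Sup_least)

lemma T_ext_upper:
  fixes c :: "'v::comm_quantale \<Rightarrow> 'u"
  assumes "w \<in> Ob T (Prod U X Y)" "Mor T (Prod U X Y) X (pr1 U) w = x"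
    "Mor T (Prod U X Y) Y (pr2 U) w = y"
  shows "\<xi> (Mor T (Prod U X Y) (range c) (\<lambda>w. c (vmap U \<phi> w)) w) \<le> T_ext U T c \<xi> X Y \<phi> x y"
  unfolding T_ext_def using assms by (auto intro!: Sup_upper)

lemma T_ext_monotone:
  fixes c :: "'v::comm_quantale \<Rightarrow> 'u"
  assumes "monotone_map U T c \<xi>"
  shows "monotone_family U T (T_ext U T c \<xi>)"
  unfolding monotone_family_def vrel_le_def
proof (intro ballI allI impI)
  fix X Y x y and \<phi> \<phi>' :: "('u, 'v) vrel"
  assume small: "X \<in> Sets U" "Y \<in> Sets U" and le: "\<forall>x\<in>X. \<forall>y\<in>Y. \<phi> x y \<le> \<phi>' x y"
  have "\<forall>w\<in>Prod U X Y. vmap U \<phi> w \<le> vmap U \<phi>' w"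
    using le by (auto simp: vmap_def elim!: ProdE)
  then have *: "\<xi> (Mor T (Prod U X Y) (range c) (\<lambda>w. c (vmap U \<phi> w)) w)
      \<le> \<xi> (Mor T (Prod U X Y) (range c) (\<lambda>w. c (vmap U \<phi>' w)) w)" if "w \<in> Ob T (Prod U X Y)" for w
    using assms that Prod_small[OF small] unfolding monotone_map_def by blast
  show "T_ext U T c \<xi> X Y \<phi> x y \<le> T_ext U T c \<xi> X Y \<phi>' x y"
  proof (rule T_ext_leI)
    fix w
    assume w: "w \<in> Ob T (Prod U X Y)" "Mor T (Prod U X Y) X (pr1 U) w = x"
      "Mor T (Prod U X Y) Y (pr2 U) w = y"
    show "\<xi> (Mor T (Prod U X Y) (range c) (\<lambda>w. c (vmap U \<phi> w)) w) \<le> T_ext U T c \<xi> X Y \<phi>' x y"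
      using *[OF w(1)] T_ext_upper[OF w] by (rule order_trans)
  qed
qed

text \<open>
  The map \<open>|\<psi>|\<close> on \<open>1 \<times> W\<close> is \<open>g\<close> after the projection to \<open>W\<close>, so all elements of \<open>T(1 \<times> W)\<close>
  over \<open>w \<in> TW\<close> have the same image \<open>Tg(w)\<close> in \<open>TV\<close>. Nothing more than \<open>\<le>\<close> can be said: if
  \<open>b\<close> and \<open>w\<close> have different images in \<open>T1\<close>, there are no such elements over \<open>b\<close>.
\<close>

lemma T_ext_One_le:
  fixes c :: "'v::comm_quantale \<Rightarrow> 'u"
  assumes "range c \<in> Sets U" "W \<in> Sets U"
    and g: "\<And>w. w \<in> W \<Longrightarrow> g w = \<psi> (pt U) w"
  shows "T_ext U T c \<xi> (One U) W \<psi> b w \<le> \<xi> (Mor T W (range c) (\<lambda>w. c (g w)) w)"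
proof (rule T_ext_leI)
  fix v
  assume v: "v \<in> Ob T (Prod U (One U) W)" "Mor T (Prod U (One U) W) W (pr2 U) v = w"
  have vals: "vmap U \<psi> u = g (pr2 U u)" if "u \<in> Prod U (One U) W" for u
    using that by (auto simp: vmap_def One_def g elim!: ProdE)
  have "Mor T (Prod U (One U) W) (range c) (\<lambda>w. c (vmap U \<psi> w)) v =
      Mor T W (range c) (\<lambda>w. c (g w)) (Mor T (Prod U (One U) W) W (pr2 U) v)"
    using assms(1,2) v(1) by (intro Mor_factor) (auto simp: One_small Prod_small pr2_maps vals)
  then show "\<xi> (Mor T (Prod U (One U) W) (range c) (\<lambda>w. c (vmap U \<psi> w)) v)
      \<le> \<xi> (Mor T W (range c) (\<lambda>w. c (g w)) w)"
    using v(2) by simp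
qed

lemma T_ext_admissible:
  fixes c :: "'v::comm_quantale \<Rightarrow> 'u"
  assumes "range c \<in> Sets U"
  shows "admissible U T (T_ext U T c \<xi>)"
  unfolding admissible_def
proof (intro ballI allI Sup_least)
  fix X Y x y v and \<phi> :: "('u, 'v) vrel"
  assume small: "X \<in> Sets U" "Y \<in> Sets U"
    and "v \<in> {T_ext U T c \<xi> (One U) (Prod U X Y) (from_one U \<phi>) b w | b w.
        b \<in> Ob T (One U) \<and> w \<in> Ob T (Prod U X Y) \<and>
        Mor T (Prod U X Y) X (pr1 U) w = x \<and> Mor T (Prod U X Y) Y (pr2 U) w = y}"
  then obtain b w where v: "v = T_ext U T c \<xi> (One U) (Prod U X Y) (from_one U \<phi>) b w"
    and w: "w \<in> Ob T (Prod U X Y)" "Mor T (Prod U X Y) X (pr1 U) w = x"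
      "Mor T (Prod U X Y) Y (pr2 U) w = y"
    by blast
  have "v \<le> \<xi> (Mor T (Prod U X Y) (range c) (\<lambda>w. c (vmap U \<phi> w)) w)"
    unfolding v using assms Prod_small[OF small] by (rule T_ext_One_le) (simp add: from_one_def)
  also have "\<dots> \<le> T_ext U T c \<xi> X Y \<phi> x y"
    using w by (rule T_ext_upper)
  finally show "v \<le> T_ext U T c \<xi> X Y \<phi> x y" .
qed

lemma T_ext_left_op_whiskering:
  fixes c :: "'v::comm_quantale \<Rightarrow> 'u"
  assumes "beck_chevalley U T" "range c \<in> Sets U"
  shows "left_op_whiskering U T (T_ext U T c \<xi>)"
  unfolding left_op_whiskering_def vrel_eq_def
proof (intro ballI allI)
  fix X Y Z h x z and \<phi> :: "('u, 'v) vrel"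
  assume small: "X \<in> Sets U" "Y \<in> Sets U" "Z \<in> Sets U" and h: "h \<in> Z \<rightarrow> Y"
    and z: "z \<in> Ob T Z"
  let ?\<psi> = "vcomp Y (op_rel h) \<phi>"
  let ?t = "Mor T (Prod U X Z) (Prod U X Y) (id_times h)"
  note maps = id_times_maps[OF h, of X] Prod_small small assms(2) pr1_maps pr2_maps h
  have t_in: "?t w \<in> Ob T (Prod U X Y)" if "w \<in> Ob T (Prod U X Z)" for w
    using that maps by (auto intro: Mor_in)
  have pr1_t: "Mor T (Prod U X Y) X (pr1 U) (?t w) = Mor T (Prod U X Z) X (pr1 U) w"
    if "w \<in> Ob T (Prod U X Z)" for w
    using that maps by (intro Mor_factor[symmetric]) auto
  have pr2_t: "Mor T (Prod U X Y) Y (pr2 U) (?t w) = Mor T Z Y h (Mor T (Prod U X Z) Z (pr2 U) w)"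
    if "w \<in> Ob T (Prod U X Z)" for w
  proof -
    have "Mor T (Prod U X Y) Y (pr2 U) (?t w) = Mor T (Prod U X Z) Y (\<lambda>w. h (pr2 U w)) w"
      using that maps by (intro Mor_factor[symmetric]) auto
    also have "\<dots> = Mor T Z Y h (Mor T (Prod U X Z) Z (pr2 U) w)"
      using that maps by (intro Mor_factor) auto
    finally show ?thesis .
  qed
  \<comment> \<open>\<open>|h\<^sup>\<circ> \<circ> \<phi>| = |\<phi>| \<cdot> (id \<times> h)\<close>, under \<open>T\<close>\<close>
  have values_t: "Mor T (Prod U X Z) (range c) (\<lambda>w. c (vmap U ?\<psi> w)) w =
      Mor T (Prod U X Y) (range c) (\<lambda>w. c (vmap U \<phi> w)) (?t w)"
    if "w \<in> Ob T (Prod U X Z)" for w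
  proof (rule Mor_factor)
    fix u assume "u \<in> Prod U X Z"
    then have "h (pr2 U u) \<in> Y"
      using h pr2_maps by blast
    then show "c (vmap U ?\<psi> u) = c (vmap U \<phi> (id_times h u))"
      by (simp add: vmap_def vcomp_op_rel)
  qed (use that maps in auto)
  have "T_ext U T c \<xi> X Z ?\<psi> x z = T_ext U T c \<xi> X Y \<phi> x (Mor T Z Y h z)"
  proof (rule antisym; rule T_ext_leI)
    fix w
    assume w: "w \<in> Ob T (Prod U X Z)" "Mor T (Prod U X Z) X (pr1 U) w = x"
      "Mor T (Prod U X Z) Z (pr2 U) w = z"
    show "\<xi> (Mor T (Prod U X Z) (range c) (\<lambda>w. c (vmap U ?\<psi> w)) w)
        \<le> T_ext U T c \<xi> X Y \<phi> x (Mor T Z Y h z)"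
      unfolding values_t[OF w(1)] using w by (intro T_ext_upper) (simp_all add: t_in pr1_t pr2_t)
  next
    fix v
    assume v: "v \<in> Ob T (Prod U X Y)" "Mor T (Prod U X Y) X (pr1 U) v = x"
      "Mor T (Prod U X Y) Y (pr2 U) v = Mor T Z Y h z"
    obtain w where w: "w \<in> Ob T (Prod U X Z)" "?t w = v" "Mor T (Prod U X Z) Z (pr2 U) w = z"
      using lift_along_product[OF assms(1) small h v(1) z v(3)] .
    have "Mor T (Prod U X Z) X (pr1 U) w = x"
      using pr1_t[OF w(1)] w(2) v(2) by simp
    then show "\<xi> (Mor T (Prod U X Y) (range c) (\<lambda>w. c (vmap U \<phi> w)) v)
        \<le> T_ext U T c \<xi> X Z ?\<psi> x z"
      using T_ext_upper[OF w(1) _ w(3)] values_t[OF w(1)] w(2) by metis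
  qed
  also have "\<dots> = vcomp (Ob T Y) (op_rel (Mor T Z Y h)) (T_ext U T c \<xi> X Y \<phi>) x z"
    using maps z by (intro vcomp_op_rel[symmetric] Mor_in)
  finally show "T_ext U T c \<xi> X Z ?\<psi> x z =
      vcomp (Ob T Y) (op_rel (Mor T Z Y h)) (T_ext U T c \<xi> X Y \<phi>) x z" .
qed

lemma Xi_T_ext:
  fixes c :: "'v::comm_quantale \<Rightarrow> 'u"
  assumes "inj c" "range c \<in> Sets U" and a: "a \<in> Ob T (range c)"
  shows "Xi U T c (T_ext U T c \<xi>) a = \<xi> a"
proof (rule antisym)
  \<comment> \<open>The join over \<open>T1\<close> is attained at the first projection of the element of \<open>T(1 \<times> V)\<close> over \<open>a\<close>.\<close>
  let ?P = "Prod U (One U) (range c)"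
  \<comment> \<open>the inverse of the projection \<open>1 \<times> V \<rightarrow> V\<close>\<close>
  let ?j = "\<lambda>v. pair U (pt U, v)"
  have c_inv: "c (inv c v) = v" if "v \<in> range c" for v
    using that by (rule f_inv_into_f)
  have "Mor T (range c) (range c) (\<lambda>v. c (inv c v)) a = Mor T (range c) (range c) (\<lambda>v. v) a"
    using assms by (intro Mor_cong) (auto simp: c_inv)
  then have inv_c: "Mor T (range c) (range c) (\<lambda>v. c (inv c v)) a = a"
    using Mor_id assms by simp
  have "T_ext U T c \<xi> (One U) (range c) (eps_one c) b a
      \<le> \<xi> (Mor T (range c) (range c) (\<lambda>v. c (inv c v)) a)" for b
    by (rule T_ext_One_le[OF assms(2,2)]) (simp add: eps_one_def)
  then show "Xi U T c (T_ext U T c \<xi>) a \<le> \<xi> a"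
    unfolding Xi_def inv_c by (rule SUP_least)
  have j: "?j \<in> range c \<rightarrow> ?P" and P: "?P \<in> Sets U"
    using assms(2) by (auto simp: One_small Prod_small intro!: pair_in_Prod) (simp add: One_def)
  define w where "w = Mor T (range c) ?P ?j a"
  define b where "b = Mor T ?P (One U) (pr1 U) w"
  have w: "w \<in> Ob T ?P"
    unfolding w_def by (rule Mor_in[OF assms(2) P j a])
  then have b: "b \<in> Ob T (One U)"
    unfolding b_def by (rule Mor_in[OF P One_small pr1_maps])
  have "Mor T ?P (range c) (pr2 U) w = Mor T (range c) (range c) (\<lambda>v. v) a"
    unfolding w_def by (rule Mor_factor[symmetric, OF assms(2) P assms(2) j pr2_maps _ a]) simp
  then have pr2_w: "Mor T ?P (range c) (pr2 U) w = a"
    by (simp only: Mor_id[OF assms(2) a])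
  have "Mor T ?P (range c) (\<lambda>w. c (vmap U (eps_one c) w)) w =
      Mor T (range c) (range c) (\<lambda>v. c (inv c v)) a"
    unfolding w_def
    by (rule Mor_factor[symmetric, OF assms(2) P assms(2) j _ _ a])
      (simp_all add: vmap_def eps_one_def)
  then have "\<xi> a = \<xi> (Mor T ?P (range c) (\<lambda>w. c (vmap U (eps_one c) w)) w)"
    by (simp only: inv_c)
  also have "\<dots> \<le> T_ext U T c \<xi> (One U) (range c) (eps_one c) b a"
    by (rule T_ext_upper[OF w b_def[symmetric] pr2_w])
  also have "\<dots> \<le> Xi U T c (T_ext U T c \<xi>) a"
    unfolding Xi_def using b by (rule SUP_upper)
  finally show "\<xi> a \<le> Xi U T c (T_ext U T c \<xi>) a" .
qed

section \<open>Minimality\<close>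

text \<open>
  Composing with \<open>|\<phi>|\<^sup>\<circ>\<close> evaluates at \<open>|\<phi>|\<close>, and \<open>\<epsilon>\<^sub>1\<close> has the value \<open>v\<close> at \<open>v\<close>; so
  \<open>\<phi>\<^sup>1 = |\<phi>|\<^sup>\<circ> \<circ> \<epsilon>\<^sub>1\<close>, and \<open>E\<close> carries this to \<open>E(\<phi>\<^sup>1) = (T|\<phi>|)\<^sup>\<circ> \<circ> E\<epsilon>\<^sub>1\<close>.
\<close>

lemma left_op_whiskering_from_one:
  fixes c :: "'v::comm_quantale \<Rightarrow> 'u" and \<phi> :: "('u, 'v) vrel"
  assumes E: "extension_family U T E" "left_op_whiskering U T E"
    and "inj c" "range c \<in> Sets U" and small: "X \<in> Sets U" "Y \<in> Sets U"
    and b: "b \<in> Ob T (One U)" and w: "w \<in> Ob T (Prod U X Y)"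
  shows "E (One U) (Prod U X Y) (from_one U \<phi>) b w =
    E (One U) (range c) (eps_one c) b (Mor T (Prod U X Y) (range c) (\<lambda>w. c (vmap U \<phi> w)) w)"
proof -
  let ?P = "Prod U X Y" and ?f = "\<lambda>w. c (vmap U \<phi> w)"
  have P: "?P \<in> Sets U" and f: "?f \<in> ?P \<rightarrow> range c"
    using small by (auto intro: Prod_small)
  have "vrel_eq (One U) ?P (from_one U \<phi>) (vcomp (range c) (op_rel ?f) (eps_one c))"
    using \<open>inj c\<close> by (simp add: vrel_eq_def vcomp_op_rel eps_one_def from_one_def)
  then have "E (One U) ?P (from_one U \<phi>) b w =
      E (One U) ?P (vcomp (range c) (op_rel ?f) (eps_one c)) b w"
    using E(1) P One_small b w unfolding extension_family_def vrel_eq_def[of "Ob T _"] by blast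
  also have "\<dots> = vcomp (Ob T (range c)) (op_rel (Mor T ?P (range c) ?f))
      (E (One U) (range c) (eps_one c)) b w"
    using E(2) P f One_small b w assms(4) unfolding left_op_whiskering_def vrel_eq_def by blast
  also have "\<dots> = E (One U) (range c) (eps_one c) b (Mor T ?P (range c) ?f w)"
    using P f w assms(4) by (intro vcomp_op_rel Mor_in)
  finally show ?thesis .
qed

lemma T_ext_least:
  fixes c :: "'v::comm_quantale \<Rightarrow> 'u"
  assumes E: "extension_family U T E" "left_op_whiskering U T E" "admissible U T E"
    and Xi: "\<And>a. a \<in> Ob T (range c) \<Longrightarrow> Xi U T c E a = \<xi> a"
    and c: "inj c" "range c \<in> Sets U"
  shows "family_le U T (T_ext U T c \<xi>) E"
  unfolding family_le_def vrel_le_def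
proof (intro ballI allI T_ext_leI)
  fix X Y x y w and \<phi> :: "('u, 'v) vrel"
  assume small: "X \<in> Sets U" "Y \<in> Sets U" and xy: "x \<in> Ob T X" "y \<in> Ob T Y"
    and w: "w \<in> Ob T (Prod U X Y)" "Mor T (Prod U X Y) X (pr1 U) w = x"
      "Mor T (Prod U X Y) Y (pr2 U) w = y"
  let ?a = "Mor T (Prod U X Y) (range c) (\<lambda>w. c (vmap U \<phi> w)) w"
  let ?S = "{E (One U) (Prod U X Y) (from_one U \<phi>) b w | b w.
      b \<in> Ob T (One U) \<and> w \<in> Ob T (Prod U X Y) \<and>
      Mor T (Prod U X Y) X (pr1 U) w = x \<and> Mor T (Prod U X Y) Y (pr2 U) w = y}"
  have "?a \<in> Ob T (range c)"
    using small c(2) w(1) by (intro Mor_in) (auto intro: Prod_small)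
  then have "\<xi> ?a = (SUP b\<in>Ob T (One U). E (One U) (range c) (eps_one c) b ?a)"
    using Xi unfolding Xi_def by simp
  also have "\<dots> = (SUP b\<in>Ob T (One U). E (One U) (Prod U X Y) (from_one U \<phi>) b w)"
    using left_op_whiskering_from_one[OF E(1,2) c small _ w(1)] by simp
  also have "\<dots> \<le> Sup ?S"
    using w by (intro SUP_least Sup_upper) blast
  also have "\<dots> \<le> E X Y \<phi> x y"
    using E(3) small xy unfolding admissible_def by blast
  finally show "\<xi> ?a \<le> E X Y \<phi> x y" .
qed

end

theorem theorem8p5:
  fixes U :: "'u universe" and T :: "'u setfunctor"
    and m e :: "'u set \<Rightarrow> 'u \<Rightarrow> 'u"
    and c :: "'v::comm_quantale \<Rightarrow> 'u" and \<xi> :: "'u \<Rightarrow> 'v"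
    and \<F> :: "('u, 'v) vfamily set"
  assumes "set_monad U T m e"
    and "beck_chevalley U T"
    and "inj c" and "range c \<in> Sets U"
    and "monotone_map U T c \<xi>"
  defines "\<F> \<equiv> {E. extension_family U T E \<and> admissible U T E \<and> left_op_whiskering U T E \<and>
    monotone_family U T E \<and> (\<forall>a\<in>Ob T (range c). Xi U T c E a = \<xi> a)}"
  shows "T_ext U T c \<xi> \<in> \<F> \<and> (\<forall>E\<in>\<F>. family_le U T (T_ext U T c \<xi>) E)"
proof -
  interpret set_functor U T
    using assms(1) by (rule set_monad.axioms)
  have "monotone_family U T (T_ext U T c \<xi>)"
    using assms(5) by (rule T_ext_monotone)
  then show ?thesis
    unfolding \<F>_def using assms(2-4)
    by (auto simp: extension_family_if_monotone T_ext_admissible T_ext_left_op_whiskering Xi_T_ext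
        intro: T_ext_least)
qed

end
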